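(* Let $\mathcal{A}$ be a 2-category and $(A,t,\eta,\mu)$ a monad in $\mathcal{A}$. Then $(A,t,\eta,\mu)$ is also a (vertical) monad in the double category of coquintets $\mathrm{co}\mathbb{Q}\mathcal{A}$, and a retromorphism of monads $(u,\theta)\colon (X,\mathrm{id}_X,1,1)\to (A,t,\eta,\mu)$ in $\mathrm{co}\mathbb{Q}\mathcal{A}$ is a 1-cell $u\colon X\to A$ together with a 2-cell $\theta\colon tu\to u$ in $\mathcal{A}$ satisfying the unit and associativity laws for a $t$-algebra. The universal such (i.e. the Eilenberg–Moore object of the vertical monad in $\mathrm{co}\mathbb{Q}\mathcal{A}$) is the Eilenberg–Moore object for $t$.
   Context: Double categories. A cell in a double category has a top $f\colon A\to B$ and bottom $g\colon C\to D$ (horizontal arrows), a left side $v\colon A\nrightarrow C$ and right side $w\colon B\nrightarrow D$ (vertical arrows). Vertical composition is written $w\bullet v$ ($v$ first), with identity $\mathrm{id}_A$. A globular cell $v\Rightarrow w$ has left $v$, right $w$ and identity top and bottom. Companions. A companion of $f\colon A\to B$ is a vertical arrow $f_*\colon A\nrightarrow B$ with cells $\psi_f$ (top $1_A$, left $\mathrm{id}_A$, right $f_*$, bottom $f$) and $\chi_f$ (top $f$, left $f_*$, right $\mathrm{id}_B$, bottom $1_B$) whose horizontal pasting ($\psi_f$ left of $\chi_f$) is the identity cell $\mathrm{id}_f$ and whose vertical pasting ($\psi_f$ above $\chi_f$) is the identity cell $1_{f_*}$. Retrocells. In a double category with companions, a retrocell with top $f$, left $v$, right $w$, bottom $g$ is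 a globular cell $w\bullet f_*\Rightarrow g_*\bullet v$. Coquintets. For a 2-category $\mathcal{A}$, $\mathrm{co}\mathbb{Q}\mathcal{A}$ has the objects of $\mathcal{A}$ as objects, the 1-cells of $\mathcal{A}$ as both horizontal and vertical arrows, and a cell with top $f$, left $h$, right $k$, bottom $g$ is a 2-cell $gh\to kf$ of $\mathcal{A}$, composed by pasting. The companion of $f$ is $f$ itself regarded as a vertical arrow. Vertical monads. A vertical monad $(A,t,\eta,\mu)$ in a double category consists of an object $A$, a vertical arrow $t\colon A\nrightarrow A$ and globular cells $\eta\colon\mathrm{id}_A\Rightarrow t$, $\mu\colon t\bullet t\Rightarrow t$ satisfying the usual unit and associativity laws (a monad in the vertical bicategory). $(X,\mathrm{id}_X,1,1)$ is the identity monad. Retromorphisms. A retromorphism of monads $(f,\phi)\colon (A,t,\eta,\mu)\to(B,s,\kappa,\nu)$ is a horizontal arrow $f\colon A\to B$ and a retrocell $\phi$ with top and bottom $f$, left $t$, right $s$, i.e. $\phi\colon s\bullet f_*\Rightarrow f_*\bullet t$, such that $\phi\circ(\kappa\bullet f_* )=f_*\bullet\eta$ and $\phi\circ(\nu\bullet f_* )=(f_*\bullet\mu)\circ(\phi\bullet t)\circ(s\bullet\phi)$. Retromorphisms compose by composing horizontal arrows and horizontally composing retrocells: for $\phi\colon s\bullet f_*\Rightarrow f_*\bullet t$ and $\phi'\colon r\bullet g_*\Rightarrow g_*\bullet s$ the composite is $r\bullet (gf)_*\cong r\bullet g_*\bullet f_*\Rightarrow g_*\bullet s\bullet f_*\Rightarrow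 g_*\bullet f_*\bullet t\cong (gf)_*\bullet t$. Eilenberg–Moore object of a vertical monad: the universal retromorphism $(u,\theta)\colon (X,\mathrm{id}_X,1,1)\to(A,t,\eta,\mu)$, i.e. every retromorphism $(Y,\mathrm{id}_Y,1,1)\to (A,t,\eta,\mu)$ factors as $(u,\theta)$ composed with (the identity-retrocell retromorphism on) a unique horizontal arrow $Y\to X$. Correspondingly, the Eilenberg–Moore object for $t$ in $\mathcal{A}$ is understood as the universal 1-cell $u\colon X\to A$ equipped with a $t$-algebra structure $\theta\colon tu\to u$. *)

theory Defs
  imports Main
begin

text \<open>
  Throughout, binary operations are written in the order of composition of functions: the
  right-hand argument comes first. For cells of a double category this means that
  \<open>\<beta> \<odot>\<^sub>h \<alpha>\<close> is the horizontal pasting with \<open>\<alpha>\<close> on the left of \<open>\<beta>\<close>, and \<open>\<beta> \<odot>\<^sub>v \<alpha>\<close> is the vertical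
  pasting with \<open>\<alpha>\<close> above \<open>\<beta>\<close>. On globular cells \<open>\<odot>\<^sub>h\<close> is thus the composition and \<open>\<odot>\<^sub>v\<close> the
  horizontal composition (whiskering) of the vertical bicategory.
\<close>

section \<open>2-categories\<close>

record ('o, 'a, 'c) two_cat =
  Ob :: "'o set"
  Ar :: "'a set"
  Tw :: "'c set"
  src :: "'a \<Rightarrow> 'o"
  tgt :: "'a \<Rightarrow> 'o"
  src2 :: "'c \<Rightarrow> 'a"
  tgt2 :: "'c \<Rightarrow> 'a"
  one :: "'o \<Rightarrow> 'a"
  comp1 :: "'a \<Rightarrow> 'a \<Rightarrow> 'a" (infixl "\<cdot>\<index>" 75)
  one2 :: "'a \<Rightarrow> 'c"
  comp2 :: "'c \<Rightarrow> 'c \<Rightarrow> 'c" (infixl "\<circ>\<^sub>2\<index>" 65)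
  hcomp2 :: "'c \<Rightarrow> 'c \<Rightarrow> 'c" (infixl "\<star>\<index>" 75)

definition arrow1 :: "('o, 'a, 'c, 'z) two_cat_scheme \<Rightarrow> 'a \<Rightarrow> 'o \<Rightarrow> 'o \<Rightarrow> bool" where
  "arrow1 \<A> f a b \<longleftrightarrow> f \<in> Ar \<A> \<and> src \<A> f = a \<and> tgt \<A> f = b"

definition arrow2 :: "('o, 'a, 'c, 'z) two_cat_scheme \<Rightarrow> 'c \<Rightarrow> 'a \<Rightarrow> 'a \<Rightarrow> bool" where
  "arrow2 \<A> \<alpha> f g \<longleftrightarrow> \<alpha> \<in> Tw \<A> \<and> src2 \<A> \<alpha> = f \<and> tgt2 \<A> \<alpha> = g"

locale two_category =
  fixes \<A> :: "('o, 'a, 'c, 'z) two_cat_scheme" (structure)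
  assumes arrow_ob: "arrow1 \<A> f a b \<Longrightarrow> a \<in> Ob \<A> \<and> b \<in> Ob \<A>"
    and one_arrow: "a \<in> Ob \<A> \<Longrightarrow> arrow1 \<A> (one \<A> a) a a"
    and comp1_arrow: "\<lbrakk>arrow1 \<A> f a b; arrow1 \<A> g b c\<rbrakk> \<Longrightarrow> arrow1 \<A> (g \<cdot> f) a c"
    and comp1_one: "arrow1 \<A> f a b \<Longrightarrow> f \<cdot> one \<A> a = f"
    and one_comp1: "arrow1 \<A> f a b \<Longrightarrow> one \<A> b \<cdot> f = f"
    and comp1_assoc: "\<lbrakk>arrow1 \<A> f a b; arrow1 \<A> g b c; arrow1 \<A> h c d\<rbrakk>
      \<Longrightarrow> (h \<cdot> g) \<cdot> f = h \<cdot> (g \<cdot> f)"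
    and arrow2_parallel: "arrow2 \<A> \<alpha> f g \<Longrightarrow> \<exists>a b. arrow1 \<A> f a b \<and> arrow1 \<A> g a b"
    and one2_arrow: "arrow1 \<A> f a b \<Longrightarrow> arrow2 \<A> (one2 \<A> f) f f"
    and comp2_arrow: "\<lbrakk>arrow2 \<A> \<alpha> f g; arrow2 \<A> \<beta> g h\<rbrakk> \<Longrightarrow> arrow2 \<A> (\<beta> \<circ>\<^sub>2 \<alpha>) f h"
    and comp2_one: "arrow2 \<A> \<alpha> f g \<Longrightarrow> \<alpha> \<circ>\<^sub>2 one2 \<A> f = \<alpha>"
    and one_comp2: "arrow2 \<A> \<alpha> f g \<Longrightarrow> one2 \<A> g \<circ>\<^sub>2 \<alpha> = \<alpha>"
    and comp2_assoc: "\<lbrakk>arrow2 \<A> \<alpha> f g; arrow2 \<A> \<beta> g h; arrow2 \<A> \<gamma> h k\<rbrakk>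
      \<Longrightarrow> (\<gamma> \<circ>\<^sub>2 \<beta>) \<circ>\<^sub>2 \<alpha> = \<gamma> \<circ>\<^sub>2 (\<beta> \<circ>\<^sub>2 \<alpha>)"
    and hcomp2_arrow: "\<lbrakk>arrow1 \<A> f a b; arrow2 \<A> \<alpha> f f'; arrow1 \<A> g b c; arrow2 \<A> \<beta> g g'\<rbrakk>
      \<Longrightarrow> arrow2 \<A> (\<beta> \<star> \<alpha>) (g \<cdot> f) (g' \<cdot> f')"
    and hcomp2_one: "\<lbrakk>arrow1 \<A> f a b; arrow2 \<A> \<alpha> f f'\<rbrakk> \<Longrightarrow> \<alpha> \<star> one2 \<A> (one \<A> a) = \<alpha>"
    and one_hcomp2: "\<lbrakk>arrow1 \<A> f a b; arrow2 \<A> \<alpha> f f'\<rbrakk> \<Longrightarrow> one2 \<A> (one \<A> b) \<star> \<alpha> = \<alpha>"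
    and hcomp2_assoc: "\<lbrakk>arrow1 \<A> f a b; arrow2 \<A> \<alpha> f f'; arrow1 \<A> g b c; arrow2 \<A> \<beta> g g';
        arrow1 \<A> h c d; arrow2 \<A> \<gamma> h h'\<rbrakk>
      \<Longrightarrow> (\<gamma> \<star> \<beta>) \<star> \<alpha> = \<gamma> \<star> (\<beta> \<star> \<alpha>)"
    and hcomp2_one2: "\<lbrakk>arrow1 \<A> f a b; arrow1 \<A> g b c\<rbrakk>
      \<Longrightarrow> one2 \<A> g \<star> one2 \<A> f = one2 \<A> (g \<cdot> f)"
    and interchange2: "\<lbrakk>arrow1 \<A> f a b; arrow2 \<A> \<alpha> f f'; arrow2 \<A> \<alpha>' f' f'';
        arrow1 \<A> g b c; arrow2 \<A> \<beta> g g'; arrow2 \<A> \<beta>' g' g''\<rbrakk>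
      \<Longrightarrow> (\<beta>' \<circ>\<^sub>2 \<beta>) \<star> (\<alpha>' \<circ>\<^sub>2 \<alpha>) = (\<beta>' \<star> \<alpha>') \<circ>\<^sub>2 (\<beta> \<star> \<alpha>)"

definition monad_2cat ::
  "('o, 'a, 'c, 'z) two_cat_scheme \<Rightarrow> 'o \<times> 'a \<times> 'c \<times> 'c \<Rightarrow> bool" where
  "monad_2cat \<A> = (\<lambda>(a, t, \<eta>, \<mu>).
     a \<in> Ob \<A> \<and> arrow1 \<A> t a a \<and>
     arrow2 \<A> \<eta> (one \<A> a) t \<and> arrow2 \<A> \<mu> (t \<cdot>\<^bsub>\<A>\<^esub> t) t \<and>
     \<mu> \<circ>\<^sub>2\<^bsub>\<A>\<^esub> (\<eta> \<star>\<^bsub>\<A>\<^esub> one2 \<A> t) = one2 \<A> t \<and>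
     \<mu> \<circ>\<^sub>2\<^bsub>\<A>\<^esub> (one2 \<A> t \<star>\<^bsub>\<A>\<^esub> \<eta>) = one2 \<A> t \<and>
     \<mu> \<circ>\<^sub>2\<^bsub>\<A>\<^esub> (\<mu> \<star>\<^bsub>\<A>\<^esub> one2 \<A> t) = \<mu> \<circ>\<^sub>2\<^bsub>\<A>\<^esub> (one2 \<A> t \<star>\<^bsub>\<A>\<^esub> \<mu>))"

definition monad_algebra ::
  "('o, 'a, 'c, 'z) two_cat_scheme \<Rightarrow> 'o \<times> 'a \<times> 'c \<times> 'c \<Rightarrow> 'o \<Rightarrow> 'a \<times> 'c \<Rightarrow> bool" where
  "monad_algebra \<A> = (\<lambda>(a, t, \<eta>, \<mu>) x (u, \<theta>).
     arrow1 \<A> u x a \<and> arrow2 \<A> \<theta> (t \<cdot>\<^bsub>\<A>\<^esub> u) u \<and>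
     \<theta> \<circ>\<^sub>2\<^bsub>\<A>\<^esub> (\<eta> \<star>\<^bsub>\<A>\<^esub> one2 \<A> u) = one2 \<A> u \<and>
     \<theta> \<circ>\<^sub>2\<^bsub>\<A>\<^esub> (\<mu> \<star>\<^bsub>\<A>\<^esub> one2 \<A> u) = \<theta> \<circ>\<^sub>2\<^bsub>\<A>\<^esub> (one2 \<A> t \<star>\<^bsub>\<A>\<^esub> \<theta>))"

text \<open>Only 1-cells \<open>y \<rightarrow> x\<close> are classified: the universal property is the one-dimensional one.\<close>

definition EM_object_2cat ::
  "('o, 'a, 'c, 'z) two_cat_scheme \<Rightarrow> 'o \<times> 'a \<times> 'c \<times> 'c \<Rightarrow> 'o \<Rightarrow> 'a \<times> 'c \<Rightarrow> bool" where
  "EM_object_2cat \<A> T x = (\<lambda>(u, \<theta>).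
     monad_algebra \<A> T x (u, \<theta>) \<and>
     (\<forall>y v \<xi>. monad_algebra \<A> T y (v, \<xi>) \<longrightarrow>
       (\<exists>!h. arrow1 \<A> h y x \<and> v = u \<cdot>\<^bsub>\<A>\<^esub> h \<and> \<xi> = \<theta> \<star>\<^bsub>\<A>\<^esub> one2 \<A> h)))"


section \<open>Double categories\<close>

text \<open>
  Horizontal composition is strict; vertical composition is associative and unital up to the
  coherent invertible globular cells
  \<open>asc x w v : (x \<bullet> w) \<bullet> v \<Rightarrow> x \<bullet> (w \<bullet> v)\<close>, \<open>lun v : id \<bullet> v \<Rightarrow> v\<close>, \<open>run v : v \<bullet> id \<Rightarrow> v\<close>, whose
  inverses \<open>asc'\<close>, \<open>lun'\<close>, \<open>run'\<close> are part of the data.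
\<close>

record ('o, 'h, 'v, 'c) dbl_cat =
  Obj :: "'o set"
  Hor :: "'h set"
  Ver :: "'v set"
  Cel :: "'c set"
  hsrc :: "'h \<Rightarrow> 'o"
  htgt :: "'h \<Rightarrow> 'o"
  vsrc :: "'v \<Rightarrow> 'o"
  vtgt :: "'v \<Rightarrow> 'o"
  top :: "'c \<Rightarrow> 'h"
  lft :: "'c \<Rightarrow> 'v"
  rgt :: "'c \<Rightarrow> 'v"
  bot :: "'c \<Rightarrow> 'h"
  hone :: "'o \<Rightarrow> 'h"
  hcomp :: "'h \<Rightarrow> 'h \<Rightarrow> 'h" (infixl "\<diamondop>\<index>" 75)
  vid :: "'o \<Rightarrow> 'v"
  vcomp :: "'v \<Rightarrow> 'v \<Rightarrow> 'v" (infixl "\<bullet>\<index>" 75)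
  hone_cell :: "'v \<Rightarrow> 'c"
  hpaste :: "'c \<Rightarrow> 'c \<Rightarrow> 'c" (infixl "\<odot>\<^sub>h\<index>" 65)
  vid_cell :: "'h \<Rightarrow> 'c"
  vpaste :: "'c \<Rightarrow> 'c \<Rightarrow> 'c" (infixl "\<odot>\<^sub>v\<index>" 75)
  asc :: "'v \<Rightarrow> 'v \<Rightarrow> 'v \<Rightarrow> 'c"
  asc' :: "'v \<Rightarrow> 'v \<Rightarrow> 'v \<Rightarrow> 'c"
  lun :: "'v \<Rightarrow> 'c"
  lun' :: "'v \<Rightarrow> 'c"
  run :: "'v \<Rightarrow> 'c"
  run' :: "'v \<Rightarrow> 'c"

definition harrow :: "('o, 'h, 'v, 'c, 'z) dbl_cat_scheme \<Rightarrow> 'h \<Rightarrow> 'o \<Rightarrow> 'o \<Rightarrow> bool" where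
  "harrow D f a b \<longleftrightarrow> f \<in> Hor D \<and> hsrc D f = a \<and> htgt D f = b"

definition varrow :: "('o, 'h, 'v, 'c, 'z) dbl_cat_scheme \<Rightarrow> 'v \<Rightarrow> 'o \<Rightarrow> 'o \<Rightarrow> bool" where
  "varrow D v a b \<longleftrightarrow> v \<in> Ver D \<and> vsrc D v = a \<and> vtgt D v = b"

text \<open>Boundaries are listed in the order top, left, right, bottom.\<close>

definition cell ::
  "('o, 'h, 'v, 'c, 'z) dbl_cat_scheme \<Rightarrow> 'c \<Rightarrow> 'h \<Rightarrow> 'v \<Rightarrow> 'v \<Rightarrow> 'h \<Rightarrow> bool" where
  "cell D \<alpha> f v w g \<longleftrightarrow>
     \<alpha> \<in> Cel D \<and> top D \<alpha> = f \<and> lft D \<alpha> = v \<and> rgt D \<alpha> = w \<and> bot D \<alpha> = g"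

definition globular :: "('o, 'h, 'v, 'c, 'z) dbl_cat_scheme \<Rightarrow> 'c \<Rightarrow> 'v \<Rightarrow> 'v \<Rightarrow> bool" where
  "globular D \<alpha> v w \<longleftrightarrow> cell D \<alpha> (hone D (vsrc D v)) v w (hone D (vtgt D v))"

locale double_category =
  fixes D :: "('o, 'h, 'v, 'c, 'z) dbl_cat_scheme" (structure)
  assumes harrow_ob: "harrow D f a b \<Longrightarrow> a \<in> Obj D \<and> b \<in> Obj D"
    and hone_arrow: "a \<in> Obj D \<Longrightarrow> harrow D (hone D a) a a"
    and hcomp_arrow: "\<lbrakk>harrow D f a b; harrow D g b c\<rbrakk> \<Longrightarrow> harrow D (g \<diamondop> f) a c"
    and hcomp_hone: "harrow D f a b \<Longrightarrow> f \<diamondop> hone D a = f"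
    and hone_hcomp: "harrow D f a b \<Longrightarrow> hone D b \<diamondop> f = f"
    and hcomp_assoc: "\<lbrakk>harrow D f a b; harrow D g b c; harrow D h c d\<rbrakk>
      \<Longrightarrow> (h \<diamondop> g) \<diamondop> f = h \<diamondop> (g \<diamondop> f)"
    and varrow_ob: "varrow D v a b \<Longrightarrow> a \<in> Obj D \<and> b \<in> Obj D"
    and vid_arrow: "a \<in> Obj D \<Longrightarrow> varrow D (vid D a) a a"
    and vcomp_arrow: "\<lbrakk>varrow D v a b; varrow D w b c\<rbrakk> \<Longrightarrow> varrow D (w \<bullet> v) a c"
    and cell_boundary: "cell D \<alpha> f v w g \<Longrightarrow>
      \<exists>a b c d. harrow D f a b \<and> varrow D v a c \<and> varrow D w b d \<and> harrow D g c d"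
    and hone_cell: "varrow D v a b \<Longrightarrow> globular D (hone_cell D v) v v"
    and hpaste_cell: "\<lbrakk>cell D \<alpha> f v w g; cell D \<beta> f' w x g'\<rbrakk>
      \<Longrightarrow> cell D (\<beta> \<odot>\<^sub>h \<alpha>) (f' \<diamondop> f) v x (g' \<diamondop> g)"
    and hpaste_hone: "cell D \<alpha> f v w g \<Longrightarrow> \<alpha> \<odot>\<^sub>h hone_cell D v = \<alpha>"
    and hone_hpaste: "cell D \<alpha> f v w g \<Longrightarrow> hone_cell D w \<odot>\<^sub>h \<alpha> = \<alpha>"
    and hpaste_assoc: "\<lbrakk>cell D \<alpha> f v w g; cell D \<beta> f' w x g'; cell D \<gamma> f'' x y g''\<rbrakk>
      \<Longrightarrow> (\<gamma> \<odot>\<^sub>h \<beta>) \<odot>\<^sub>h \<alpha> = \<gamma> \<odot>\<^sub>h (\<beta> \<odot>\<^sub>h \<alpha>)"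
    and vid_cell: "harrow D f a b \<Longrightarrow> cell D (vid_cell D f) f (vid D a) (vid D b) f"
    and vpaste_cell: "\<lbrakk>cell D \<alpha> f v w g; cell D \<beta> g v' w' h\<rbrakk>
      \<Longrightarrow> cell D (\<beta> \<odot>\<^sub>v \<alpha>) f (v' \<bullet> v) (w' \<bullet> w) h"
    and vid_cell_hone: "a \<in> Obj D \<Longrightarrow> vid_cell D (hone D a) = hone_cell D (vid D a)"
    and vid_cell_hcomp: "\<lbrakk>harrow D f a b; harrow D g b c\<rbrakk>
      \<Longrightarrow> vid_cell D (g \<diamondop> f) = vid_cell D g \<odot>\<^sub>h vid_cell D f"
    and hone_cell_vcomp: "\<lbrakk>varrow D v a b; varrow D w b c\<rbrakk>
      \<Longrightarrow> hone_cell D (w \<bullet> v) = hone_cell D w \<odot>\<^sub>v hone_cell D v"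
    and interchange: "\<lbrakk>cell D \<alpha> f v w g; cell D \<beta> f' w x g'; cell D \<gamma> g v' w' h; cell D \<delta> g' w' x' h'\<rbrakk>
      \<Longrightarrow> (\<delta> \<odot>\<^sub>h \<gamma>) \<odot>\<^sub>v (\<beta> \<odot>\<^sub>h \<alpha>) = (\<delta> \<odot>\<^sub>v \<beta>) \<odot>\<^sub>h (\<gamma> \<odot>\<^sub>v \<alpha>)"
    and asc_cell: "\<lbrakk>varrow D v a b; varrow D w b c; varrow D x c d\<rbrakk> \<Longrightarrow>
      globular D (asc D x w v) ((x \<bullet> w) \<bullet> v) (x \<bullet> (w \<bullet> v)) \<and>
      globular D (asc' D x w v) (x \<bullet> (w \<bullet> v)) ((x \<bullet> w) \<bullet> v) \<and>
      asc' D x w v \<odot>\<^sub>h asc D x w v = hone_cell D ((x \<bullet> w) \<bullet> v) \<and>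
      asc D x w v \<odot>\<^sub>h asc' D x w v = hone_cell D (x \<bullet> (w \<bullet> v))"
    and asc_natural: "\<lbrakk>cell D \<alpha> f v v' g; cell D \<beta> g w w' h; cell D \<gamma> h x x' k\<rbrakk> \<Longrightarrow>
      asc D x' w' v' \<odot>\<^sub>h ((\<gamma> \<odot>\<^sub>v \<beta>) \<odot>\<^sub>v \<alpha>) = (\<gamma> \<odot>\<^sub>v (\<beta> \<odot>\<^sub>v \<alpha>)) \<odot>\<^sub>h asc D x w v"
    and lun_cell: "varrow D v a b \<Longrightarrow>
      globular D (lun D v) (vid D b \<bullet> v) v \<and> globular D (lun' D v) v (vid D b \<bullet> v) \<and>
      lun' D v \<odot>\<^sub>h lun D v = hone_cell D (vid D b \<bullet> v) \<and> lun D v \<odot>\<^sub>h lun' D v = hone_cell D v"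
    and lun_natural: "cell D \<alpha> f v w g \<Longrightarrow>
      lun D w \<odot>\<^sub>h (vid_cell D g \<odot>\<^sub>v \<alpha>) = \<alpha> \<odot>\<^sub>h lun D v"
    and run_cell: "varrow D v a b \<Longrightarrow>
      globular D (run D v) (v \<bullet> vid D a) v \<and> globular D (run' D v) v (v \<bullet> vid D a) \<and>
      run' D v \<odot>\<^sub>h run D v = hone_cell D (v \<bullet> vid D a) \<and> run D v \<odot>\<^sub>h run' D v = hone_cell D v"
    and run_natural: "cell D \<alpha> f v w g \<Longrightarrow>
      run D w \<odot>\<^sub>h (\<alpha> \<odot>\<^sub>v vid_cell D f) = \<alpha> \<odot>\<^sub>h run D v"
    and pentagon: "\<lbrakk>varrow D v a b; varrow D w b c; varrow D x c d; varrow D y d e\<rbrakk> \<Longrightarrow>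
      asc D y x (w \<bullet> v) \<odot>\<^sub>h asc D (y \<bullet> x) w v =
      (hone_cell D y \<odot>\<^sub>v asc D x w v) \<odot>\<^sub>h asc D y (x \<bullet> w) v \<odot>\<^sub>h (asc D y x w \<odot>\<^sub>v hone_cell D v)"
    and triangle: "\<lbrakk>varrow D v a b; varrow D w b c\<rbrakk> \<Longrightarrow>
      (hone_cell D w \<odot>\<^sub>v lun D v) \<odot>\<^sub>h asc D w (vid D b) v = run D w \<odot>\<^sub>v hone_cell D v"


section \<open>Companions\<close>

definition is_companion ::
  "('o, 'h, 'v, 'c, 'z) dbl_cat_scheme \<Rightarrow> 'h \<Rightarrow> 'v \<Rightarrow> 'c \<Rightarrow> 'c \<Rightarrow> bool" where
  "is_companion D f p \<psi> \<chi> \<longleftrightarrow>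
     varrow D p (hsrc D f) (htgt D f) \<and>
     cell D \<psi> (hone D (hsrc D f)) (vid D (hsrc D f)) p f \<and>
     cell D \<chi> f p (vid D (htgt D f)) (hone D (htgt D f)) \<and>
     \<chi> \<odot>\<^sub>h\<^bsub>D\<^esub> \<psi> = vid_cell D f \<and>
     lun D p \<odot>\<^sub>h\<^bsub>D\<^esub> (\<chi> \<odot>\<^sub>v\<^bsub>D\<^esub> \<psi>) = run D p"

text \<open>A double category with companions carries a choice of companion \<open>f\<^sub>*\<close> = \<open>cmp f\<close> for every
  horizontal arrow \<open>f\<close>.\<close>

record ('o, 'h, 'v, 'c) dbl_cat_cmp = "('o, 'h, 'v, 'c) dbl_cat" +
  cmp :: "'h \<Rightarrow> 'v"
  cpsi :: "'h \<Rightarrow> 'c"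
  cchi :: "'h \<Rightarrow> 'c"

locale double_category_with_companions = double_category D
  for D :: "('o, 'h, 'v, 'c, 'z) dbl_cat_cmp_scheme" (structure) +
  assumes companion: "harrow D f a b \<Longrightarrow> is_companion D f (cmp D f) (cpsi D f) (cchi D f)"

text \<open>
  For \<open>f : a \<rightarrow> b\<close> and \<open>g : b \<rightarrow> c\<close>, pasting the binding cells of \<open>f\<^sub>*\<close> and \<open>g\<^sub>*\<close> makes \<open>g\<^sub>* \<bullet> f\<^sub>*\<close> a companion
  of \<open>g f\<close>; comparing it with \<open>(g f)\<^sub>*\<close> gives the canonical isomorphism \<open>(g f)\<^sub>* \<cong> g\<^sub>* \<bullet> f\<^sub>*\<close>.
\<close>

definition comp_psi :: "('o, 'h, 'v, 'c, 'z) dbl_cat_cmp_scheme \<Rightarrow> 'h \<Rightarrow> 'h \<Rightarrow> 'c" where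
  "comp_psi D g f =
     (cpsi D g \<odot>\<^sub>v\<^bsub>D\<^esub> hone_cell D (cmp D f)) \<odot>\<^sub>h\<^bsub>D\<^esub> (vid_cell D f \<odot>\<^sub>v\<^bsub>D\<^esub> cpsi D f)
       \<odot>\<^sub>h\<^bsub>D\<^esub> lun' D (vid D (hsrc D f))"

definition comp_chi :: "('o, 'h, 'v, 'c, 'z) dbl_cat_cmp_scheme \<Rightarrow> 'h \<Rightarrow> 'h \<Rightarrow> 'c" where
  "comp_chi D g f =
     lun D (vid D (htgt D g)) \<odot>\<^sub>h\<^bsub>D\<^esub>
       (cchi D g \<odot>\<^sub>v\<^bsub>D\<^esub> vid_cell D g) \<odot>\<^sub>h\<^bsub>D\<^esub> (hone_cell D (cmp D g) \<odot>\<^sub>v\<^bsub>D\<^esub> cchi D f)"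

definition cmp_split :: "('o, 'h, 'v, 'c, 'z) dbl_cat_cmp_scheme \<Rightarrow> 'h \<Rightarrow> 'h \<Rightarrow> 'c" where
  "cmp_split D g f =
     lun D (cmp D g \<bullet>\<^bsub>D\<^esub> cmp D f) \<odot>\<^sub>h\<^bsub>D\<^esub> (cchi D (g \<diamondop>\<^bsub>D\<^esub> f) \<odot>\<^sub>v\<^bsub>D\<^esub> comp_psi D g f)
       \<odot>\<^sub>h\<^bsub>D\<^esub> run' D (cmp D (g \<diamondop>\<^bsub>D\<^esub> f))"

definition cmp_merge :: "('o, 'h, 'v, 'c, 'z) dbl_cat_cmp_scheme \<Rightarrow> 'h \<Rightarrow> 'h \<Rightarrow> 'c" where
  "cmp_merge D g f =
     lun D (cmp D (g \<diamondop>\<^bsub>D\<^esub> f)) \<odot>\<^sub>h\<^bsub>D\<^esub> (comp_chi D g f \<odot>\<^sub>v\<^bsub>D\<^esub> cpsi D (g \<diamondop>\<^bsub>D\<^esub> f))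
       \<odot>\<^sub>h\<^bsub>D\<^esub> run' D (cmp D g \<bullet>\<^bsub>D\<^esub> cmp D f)"


section \<open>Retrocells\<close>

definition retrocell ::
  "('o, 'h, 'v, 'c, 'z) dbl_cat_cmp_scheme \<Rightarrow> 'c \<Rightarrow> 'h \<Rightarrow> 'v \<Rightarrow> 'v \<Rightarrow> 'h \<Rightarrow> bool" where
  "retrocell D \<phi> f v w g \<longleftrightarrow>
     harrow D f (vsrc D v) (vsrc D w) \<and> harrow D g (vtgt D v) (vtgt D w) \<and>
     v \<in> Ver D \<and> w \<in> Ver D \<and>
     globular D \<phi> (w \<bullet>\<^bsub>D\<^esub> cmp D f) (cmp D g \<bullet>\<^bsub>D\<^esub> v)"

text \<open>
  Horizontal composite of a retrocell \<open>\<phi>\<close> with boundary \<open>f, v, w, g\<close> followed by a retrocell \<open>\<phi>'\<close>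
  with boundary \<open>f', w, x, g'\<close>:
  \<open>x \<bullet> (f'f)\<^sub>* \<Rightarrow> x \<bullet> (f'\<^sub>* \<bullet> f\<^sub>*) \<Rightarrow> (x \<bullet> f'\<^sub>*) \<bullet> f\<^sub>* \<Rightarrow> (g'\<^sub>* \<bullet> w) \<bullet> f\<^sub>* \<Rightarrow> g'\<^sub>* \<bullet> (w \<bullet> f\<^sub>*) \<Rightarrow> g'\<^sub>* \<bullet> (g\<^sub>* \<bullet> v)
    \<Rightarrow> (g'\<^sub>* \<bullet> g\<^sub>*) \<bullet> v \<Rightarrow> (g'g)\<^sub>* \<bullet> v\<close>.
\<close>

definition retrocell_comp ::
  "('o, 'h, 'v, 'c, 'z) dbl_cat_cmp_scheme \<Rightarrow>
     'h \<Rightarrow> 'v \<Rightarrow> 'v \<Rightarrow> 'h \<Rightarrow> 'c \<Rightarrow> 'h \<Rightarrow> 'v \<Rightarrow> 'h \<Rightarrow> 'c \<Rightarrow> 'c" where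
  "retrocell_comp D f v w g \<phi> f' x g' \<phi>' =
     (cmp_merge D g' g \<odot>\<^sub>v\<^bsub>D\<^esub> hone_cell D v) \<odot>\<^sub>h\<^bsub>D\<^esub>
     asc' D (cmp D g') (cmp D g) v \<odot>\<^sub>h\<^bsub>D\<^esub>
     (hone_cell D (cmp D g') \<odot>\<^sub>v\<^bsub>D\<^esub> \<phi>) \<odot>\<^sub>h\<^bsub>D\<^esub>
     asc D (cmp D g') w (cmp D f) \<odot>\<^sub>h\<^bsub>D\<^esub>
     (\<phi>' \<odot>\<^sub>v\<^bsub>D\<^esub> hone_cell D (cmp D f)) \<odot>\<^sub>h\<^bsub>D\<^esub>
     asc' D x (cmp D f') (cmp D f) \<odot>\<^sub>h\<^bsub>D\<^esub>
     (hone_cell D x \<odot>\<^sub>v\<^bsub>D\<^esub> cmp_split D f' f)"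

text \<open>The identity retrocell \<open>id \<bullet> f\<^sub>* \<Rightarrow> f\<^sub>* \<Rightarrow> f\<^sub>* \<bullet> id\<close> with top and bottom \<open>f\<close>.\<close>

definition id_retrocell :: "('o, 'h, 'v, 'c, 'z) dbl_cat_cmp_scheme \<Rightarrow> 'h \<Rightarrow> 'c" where
  "id_retrocell D f = run' D (cmp D f) \<odot>\<^sub>h\<^bsub>D\<^esub> lun D (cmp D f)"


section \<open>Vertical monads and retromorphisms\<close>

definition vertical_monad ::
  "('o, 'h, 'v, 'c, 'z) dbl_cat_scheme \<Rightarrow> 'o \<times> 'v \<times> 'c \<times> 'c \<Rightarrow> bool" where
  "vertical_monad D = (\<lambda>(a, t, \<eta>, \<mu>).
     a \<in> Obj D \<and> varrow D t a a \<and>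
     globular D \<eta> (vid D a) t \<and> globular D \<mu> (t \<bullet>\<^bsub>D\<^esub> t) t \<and>
     \<mu> \<odot>\<^sub>h\<^bsub>D\<^esub> (\<eta> \<odot>\<^sub>v\<^bsub>D\<^esub> hone_cell D t) = lun D t \<and>
     \<mu> \<odot>\<^sub>h\<^bsub>D\<^esub> (hone_cell D t \<odot>\<^sub>v\<^bsub>D\<^esub> \<eta>) = run D t \<and>
     \<mu> \<odot>\<^sub>h\<^bsub>D\<^esub> (\<mu> \<odot>\<^sub>v\<^bsub>D\<^esub> hone_cell D t) = \<mu> \<odot>\<^sub>h\<^bsub>D\<^esub> (hone_cell D t \<odot>\<^sub>v\<^bsub>D\<^esub> \<mu>) \<odot>\<^sub>h\<^bsub>D\<^esub> asc D t t t)"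

text \<open>The multiplication \<open>id \<bullet> id \<Rightarrow> id\<close> of the identity monad is the unit constraint; it is an
  identity cell when vertical composition is strict.\<close>

definition id_monad :: "('o, 'h, 'v, 'c, 'z) dbl_cat_scheme \<Rightarrow> 'o \<Rightarrow> 'o \<times> 'v \<times> 'c \<times> 'c" where
  "id_monad D a = (a, vid D a, hone_cell D (vid D a), lun D (vid D a))"

text \<open>The two laws are \<open>\<phi> \<circ> (\<kappa> \<bullet> f\<^sub>*) = f\<^sub>* \<bullet> \<eta>\<close> and \<open>\<phi> \<circ> (\<nu> \<bullet> f\<^sub>*) = (f\<^sub>* \<bullet> \<mu>) \<circ> (\<phi> \<bullet> t) \<circ> (s \<bullet> \<phi>)\<close>, with
  the constraint cells inserted.\<close>

definition retromorphism ::
  "('o, 'h, 'v, 'c, 'z) dbl_cat_cmp_scheme \<Rightarrow>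
     'o \<times> 'v \<times> 'c \<times> 'c \<Rightarrow> 'o \<times> 'v \<times> 'c \<times> 'c \<Rightarrow> 'h \<times> 'c \<Rightarrow> bool" where
  "retromorphism D = (\<lambda>(a, t, \<eta>, \<mu>) (b, s, \<kappa>, \<nu>) (f, \<phi>).
     harrow D f a b \<and> retrocell D \<phi> f t s f \<and>
     \<phi> \<odot>\<^sub>h\<^bsub>D\<^esub> (\<kappa> \<odot>\<^sub>v\<^bsub>D\<^esub> hone_cell D (cmp D f)) =
       (hone_cell D (cmp D f) \<odot>\<^sub>v\<^bsub>D\<^esub> \<eta>) \<odot>\<^sub>h\<^bsub>D\<^esub> run' D (cmp D f) \<odot>\<^sub>h\<^bsub>D\<^esub> lun D (cmp D f) \<and>
     \<phi> \<odot>\<^sub>h\<^bsub>D\<^esub> (\<nu> \<odot>\<^sub>v\<^bsub>D\<^esub> hone_cell D (cmp D f)) =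
       (hone_cell D (cmp D f) \<odot>\<^sub>v\<^bsub>D\<^esub> \<mu>) \<odot>\<^sub>h\<^bsub>D\<^esub>
       asc D (cmp D f) t t \<odot>\<^sub>h\<^bsub>D\<^esub>
       (\<phi> \<odot>\<^sub>v\<^bsub>D\<^esub> hone_cell D t) \<odot>\<^sub>h\<^bsub>D\<^esub>
       asc' D s (cmp D f) t \<odot>\<^sub>h\<^bsub>D\<^esub>
       (hone_cell D s \<odot>\<^sub>v\<^bsub>D\<^esub> \<phi>) \<odot>\<^sub>h\<^bsub>D\<^esub>
       asc D s s (cmp D f))"

definition retromorphism_comp ::
  "('o, 'h, 'v, 'c, 'z) dbl_cat_cmp_scheme \<Rightarrow>
     'o \<times> 'v \<times> 'c \<times> 'c \<Rightarrow> 'o \<times> 'v \<times> 'c \<times> 'c \<Rightarrow> 'o \<times> 'v \<times> 'c \<times> 'c \<Rightarrow>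
     'h \<times> 'c \<Rightarrow> 'h \<times> 'c \<Rightarrow> 'h \<times> 'c" where
  "retromorphism_comp D = (\<lambda>(a, t, _, _) (b, s, _, _) (c, r, _, _) (g, \<phi>') (f, \<phi>).
     (g \<diamondop>\<^bsub>D\<^esub> f, retrocell_comp D f t s f \<phi> g r g \<phi>'))"

definition EM_object ::
  "('o, 'h, 'v, 'c, 'z) dbl_cat_cmp_scheme \<Rightarrow>
     'o \<times> 'v \<times> 'c \<times> 'c \<Rightarrow> 'o \<Rightarrow> 'h \<times> 'c \<Rightarrow> bool" where
  "EM_object D T x U \<longleftrightarrow>
     x \<in> Obj D \<and> retromorphism D (id_monad D x) T U \<and>
     (\<forall>y \<in> Obj D. \<forall>V. retromorphism D (id_monad D y) T V \<longrightarrow>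
       (\<exists>!h. harrow D h y x \<and>
         V = retromorphism_comp D (id_monad D y) (id_monad D x) T U (h, id_retrocell D h)))"


section \<open>Coquintets\<close>

text \<open>\<open>Coquintet f h k g \<alpha>\<close> has top \<open>f\<close>, left \<open>h\<close>, right \<open>k\<close>, bottom \<open>g\<close> and \<open>\<alpha> : g h \<rightarrow> k f\<close>.\<close>

datatype ('a, 'c) coquintet =
  Coquintet (ctop: 'a) (cleft: 'a) (cright: 'a) (cbot: 'a) (ctwo: 'c)

definition coquintets :: "('o, 'a, 'c, 'z) two_cat_scheme \<Rightarrow> ('a, 'c) coquintet set" where
  "coquintets \<A> = {Coquintet f h k g \<alpha> | f h k g \<alpha>.
     (\<exists>a b c d. arrow1 \<A> f a b \<and> arrow1 \<A> h a c \<and> arrow1 \<A> k b d \<and> arrow1 \<A> g c d) \<and>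
     arrow2 \<A> \<alpha> (g \<cdot>\<^bsub>\<A>\<^esub> h) (k \<cdot>\<^bsub>\<A>\<^esub> f)}"

text \<open>A 2-cell \<open>\<alpha> : h \<rightarrow> k\<close> regarded as a globular cell of the double category of coquintets.\<close>

definition glob :: "('o, 'a, 'c, 'z) two_cat_scheme \<Rightarrow> 'c \<Rightarrow> ('a, 'c) coquintet" where
  "glob \<A> \<alpha> = Coquintet (one \<A> (src \<A> (src2 \<A> \<alpha>))) (src2 \<A> \<alpha>) (tgt2 \<A> \<alpha>)
     (one \<A> (tgt \<A> (src2 \<A> \<alpha>))) \<alpha>"

text \<open>Vertical composition of coquintets is strict, so all constraint cells are identities.\<close>

definition coQ ::
  "('o, 'a, 'c, 'z) two_cat_scheme \<Rightarrow> ('o, 'a, 'a, ('a, 'c) coquintet) dbl_cat_cmp" where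
  "coQ \<A> = \<lparr>
     Obj = Ob \<A>, Hor = Ar \<A>, Ver = Ar \<A>, Cel = coquintets \<A>,
     hsrc = src \<A>, htgt = tgt \<A>, vsrc = src \<A>, vtgt = tgt \<A>,
     top = ctop, lft = cleft, rgt = cright, bot = cbot,
     hone = one \<A>, hcomp = comp1 \<A>, vid = one \<A>, vcomp = comp1 \<A>,
     hone_cell = (\<lambda>v. glob \<A> (one2 \<A> v)),
     hpaste = (\<lambda>\<beta> \<alpha>.
       Coquintet (ctop \<beta> \<cdot>\<^bsub>\<A>\<^esub> ctop \<alpha>) (cleft \<alpha>) (cright \<beta>) (cbot \<beta> \<cdot>\<^bsub>\<A>\<^esub> cbot \<alpha>)
         ((ctwo \<beta> \<star>\<^bsub>\<A>\<^esub> one2 \<A> (ctop \<alpha>)) \<circ>\<^sub>2\<^bsub>\<A>\<^esub> (one2 \<A> (cbot \<beta>) \<star>\<^bsub>\<A>\<^esub> ctwo \<alpha>))),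
     vid_cell = (\<lambda>f. Coquintet f (one \<A> (src \<A> f)) (one \<A> (tgt \<A> f)) f (one2 \<A> f)),
     vpaste = (\<lambda>\<beta> \<alpha>.
       Coquintet (ctop \<alpha>) (cleft \<beta> \<cdot>\<^bsub>\<A>\<^esub> cleft \<alpha>) (cright \<beta> \<cdot>\<^bsub>\<A>\<^esub> cright \<alpha>) (cbot \<beta>)
         ((one2 \<A> (cright \<beta>) \<star>\<^bsub>\<A>\<^esub> ctwo \<alpha>) \<circ>\<^sub>2\<^bsub>\<A>\<^esub> (ctwo \<beta> \<star>\<^bsub>\<A>\<^esub> one2 \<A> (cleft \<alpha>)))),
     asc = (\<lambda>x w v. glob \<A> (one2 \<A> (x \<cdot>\<^bsub>\<A>\<^esub> w \<cdot>\<^bsub>\<A>\<^esub> v))),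
     asc' = (\<lambda>x w v. glob \<A> (one2 \<A> (x \<cdot>\<^bsub>\<A>\<^esub> w \<cdot>\<^bsub>\<A>\<^esub> v))),
     lun = (\<lambda>v. glob \<A> (one2 \<A> v)), lun' = (\<lambda>v. glob \<A> (one2 \<A> v)),
     run = (\<lambda>v. glob \<A> (one2 \<A> v)), run' = (\<lambda>v. glob \<A> (one2 \<A> v)),
     cmp = (\<lambda>f. f),
     cpsi = (\<lambda>f. Coquintet (one \<A> (src \<A> f)) (one \<A> (src \<A> f)) f f (one2 \<A> f)),
     cchi = (\<lambda>f. Coquintet f f (one \<A> (tgt \<A> f)) (one \<A> (tgt \<A> f)) (one2 \<A> f)) \<rparr>"

end

theory Submission
  imports Defs
begin

text \<open>
  The double category of coquintets has only one kind of arrow and its vertical composition is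
  strict, so every structural ingredient of the notion of retromorphism becomes trivial. The
  companion of \<open>f\<close> is \<open>f\<close>, and the constraints, the comparison \<open>(g f)\<^sub>* \<cong> g\<^sub>* \<bullet> f\<^sub>*\<close> and the identity
  retrocells are all identity 2-cells.

  A globular coquintet is a 2-cell whose boundary has been padded with identity 1-cells, and
  \<open>glob\<close> does this padding. It is injective, reaches every globular coquintet (\<open>globularE\<close>), and
  turns \<open>\<circ>\<^sub>2\<close> and \<open>\<star>\<close> into horizontal and vertical pasting (\<open>pasting_glob\<close>). Equations between
  pastings of globular coquintets are therefore equations between 2-cells. Read in this way, the
  laws of a vertical monad are the monad laws, and a retromorphism out of the identity monad on
  \<open>X\<close> has as its retrocell \<open>t \<bullet> u\<^sub>* \<Rightarrow> u\<^sub>* \<bullet> id\<close> a 2-cell \<open>\<theta> : t u \<rightarrow> u\<close>, with the unit and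
  associativity laws of an algebra (\<open>retromorphism_coQ_iff\<close>).

  Composing \<open>(u, \<theta>)\<close> with the identity retrocell on \<open>h\<close> whiskers it to \<open>(u h, \<theta> \<star> 1\<^sub>h)\<close>
  (\<open>retromorphism_comp_coQ\<close>), which is how \<open>h\<close> acts on algebras. The two universal properties thus
  quantify over corresponding data and ask for the same factorizations (\<open>EM_object_coQ_iff\<close>).

  That coquintets form a double category at all comes down to normalizing composites of whiskered
  2-cells. All axioms except interchange hold as soon as both sides are expanded; interchange also
  uses that two 2-cells acting on disjoint parts of a composite 1-cell commute
  (\<open>whisker_exchange\<close>).
\<close>

section \<open>Normalizing composites in a 2-category\<close>

context two_category
begin

text \<open>
  The axioms speak of arrows with named endpoints, which a rewriter would have to guess. Below they
  are restated with sources and targets computed by functions, so that every side condition is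
  an equation or a membership that rewriting decides. As rewrite rules they bring a pasted 2-cell into the
  form of a right-nested \<open>\<circ>\<^sub>2\<close>-composite of whiskered 2-cells.
\<close>

lemma src_tgt_ob [simp]:
  assumes "f \<in> Ar \<A>" shows "src \<A> f \<in> Ob \<A>" "tgt \<A> f \<in> Ob \<A>"
  using arrow_ob[of f "src \<A> f" "tgt \<A> f"] assms by (auto simp: arrow1_def)

lemma one_simps [simp]:
  assumes "a \<in> Ob \<A>"
  shows "one \<A> a \<in> Ar \<A>" "src \<A> (one \<A> a) = a" "tgt \<A> (one \<A> a) = a"
  using one_arrow[OF assms] by (auto simp: arrow1_def)

lemma comp1_simps [simp]:
  assumes "f \<in> Ar \<A>" "g \<in> Ar \<A>" "src \<A> g = tgt \<A> f"
  shows "g \<cdot> f \<in> Ar \<A>" "src \<A> (g \<cdot> f) = src \<A> f" "tgt \<A> (g \<cdot> f) = tgt \<A> g"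
  using comp1_arrow[of f "src \<A> f" "tgt \<A> f" g "tgt \<A> g"] assms by (auto simp: arrow1_def)

lemma comp1_unit [simp]:
  assumes "f \<in> Ar \<A>"
  shows "src \<A> f = a \<Longrightarrow> f \<cdot> one \<A> a = f" "tgt \<A> f = b \<Longrightarrow> one \<A> b \<cdot> f = f"
  using comp1_one[of f "src \<A> f" "tgt \<A> f"] one_comp1[of f "src \<A> f" "tgt \<A> f"] assms
  by (auto simp: arrow1_def)

lemma comp1_assoc' [simp]:
  assumes "f \<in> Ar \<A>" "g \<in> Ar \<A>" "h \<in> Ar \<A>" "src \<A> g = tgt \<A> f" "src \<A> h = tgt \<A> g"
  shows "h \<cdot> g \<cdot> f = h \<cdot> (g \<cdot> f)"
  using comp1_assoc[of f "src \<A> f" "tgt \<A> f" g "tgt \<A> g" h "tgt \<A> h"] assms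
  by (auto simp: arrow1_def)

lemma two_cell_boundary [simp]:
  assumes "\<alpha> \<in> Tw \<A>"
  shows "src2 \<A> \<alpha> \<in> Ar \<A>" "tgt2 \<A> \<alpha> \<in> Ar \<A>"
    "src \<A> (tgt2 \<A> \<alpha>) = src \<A> (src2 \<A> \<alpha>)" "tgt \<A> (tgt2 \<A> \<alpha>) = tgt \<A> (src2 \<A> \<alpha>)"
  using arrow2_parallel[of \<alpha> "src2 \<A> \<alpha>" "tgt2 \<A> \<alpha>"] assms
  by (auto simp: arrow1_def arrow2_def)

lemma one2_simps [simp]:
  assumes "f \<in> Ar \<A>"
  shows "one2 \<A> f \<in> Tw \<A>" "src2 \<A> (one2 \<A> f) = f" "tgt2 \<A> (one2 \<A> f) = f"
  using one2_arrow[of f "src \<A> f" "tgt \<A> f"] assms by (auto simp: arrow1_def arrow2_def)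

lemma comp2_simps [simp]:
  assumes "\<alpha> \<in> Tw \<A>" "\<beta> \<in> Tw \<A>" "src2 \<A> \<beta> = tgt2 \<A> \<alpha>"
  shows "\<beta> \<circ>\<^sub>2 \<alpha> \<in> Tw \<A>" "src2 \<A> (\<beta> \<circ>\<^sub>2 \<alpha>) = src2 \<A> \<alpha>" "tgt2 \<A> (\<beta> \<circ>\<^sub>2 \<alpha>) = tgt2 \<A> \<beta>"
  using comp2_arrow[of \<alpha> "src2 \<A> \<alpha>" "tgt2 \<A> \<alpha>" \<beta> "tgt2 \<A> \<beta>"] assms by (auto simp: arrow2_def)

lemma comp2_unit [simp]:
  assumes "\<alpha> \<in> Tw \<A>"
  shows "src2 \<A> \<alpha> = f \<Longrightarrow> \<alpha> \<circ>\<^sub>2 one2 \<A> f = \<alpha>" "tgt2 \<A> \<alpha> = g \<Longrightarrow> one2 \<A> g \<circ>\<^sub>2 \<alpha> = \<alpha>"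
  using comp2_one[of \<alpha> f "tgt2 \<A> \<alpha>"] one_comp2[of \<alpha> "src2 \<A> \<alpha>" g] assms
  by (auto simp: arrow2_def)

lemma comp2_assoc' [simp]:
  assumes "\<alpha> \<in> Tw \<A>" "\<beta> \<in> Tw \<A>" "\<gamma> \<in> Tw \<A>" "src2 \<A> \<beta> = tgt2 \<A> \<alpha>" "src2 \<A> \<gamma> = tgt2 \<A> \<beta>"
  shows "\<gamma> \<circ>\<^sub>2 \<beta> \<circ>\<^sub>2 \<alpha> = \<gamma> \<circ>\<^sub>2 (\<beta> \<circ>\<^sub>2 \<alpha>)"
  using comp2_assoc[of \<alpha> "src2 \<A> \<alpha>" "tgt2 \<A> \<alpha>" \<beta> "tgt2 \<A> \<beta>" \<gamma> "tgt2 \<A> \<gamma>"] assms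
  by (auto simp: arrow2_def)

lemma hcomp2_simps [simp]:
  assumes "\<alpha> \<in> Tw \<A>" "\<beta> \<in> Tw \<A>" "src \<A> (src2 \<A> \<beta>) = tgt \<A> (src2 \<A> \<alpha>)"
  shows "\<beta> \<star> \<alpha> \<in> Tw \<A>" "src2 \<A> (\<beta> \<star> \<alpha>) = src2 \<A> \<beta> \<cdot> src2 \<A> \<alpha>"
    "tgt2 \<A> (\<beta> \<star> \<alpha>) = tgt2 \<A> \<beta> \<cdot> tgt2 \<A> \<alpha>"
  using hcomp2_arrow[of "src2 \<A> \<alpha>" "src \<A> (src2 \<A> \<alpha>)" "tgt \<A> (src2 \<A> \<alpha>)" \<alpha> "tgt2 \<A> \<alpha>"
      "src2 \<A> \<beta>" "tgt \<A> (src2 \<A> \<beta>)" \<beta> "tgt2 \<A> \<beta>"] assms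
  by (auto simp: arrow1_def arrow2_def)

lemma hcomp2_unit [simp]:
  assumes "\<alpha> \<in> Tw \<A>"
  shows "src \<A> (src2 \<A> \<alpha>) = a \<Longrightarrow> \<alpha> \<star> one2 \<A> (one \<A> a) = \<alpha>"
    "tgt \<A> (src2 \<A> \<alpha>) = b \<Longrightarrow> one2 \<A> (one \<A> b) \<star> \<alpha> = \<alpha>"
  using hcomp2_one[of "src2 \<A> \<alpha>" a "tgt \<A> (src2 \<A> \<alpha>)" \<alpha> "tgt2 \<A> \<alpha>"]
    one_hcomp2[of "src2 \<A> \<alpha>" "src \<A> (src2 \<A> \<alpha>)" b \<alpha> "tgt2 \<A> \<alpha>"] assms
  by (auto simp: arrow1_def arrow2_def)

lemma hcomp2_assoc' [simp]:
  assumes "\<alpha> \<in> Tw \<A>" "\<beta> \<in> Tw \<A>" "\<gamma> \<in> Tw \<A>"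
    "src \<A> (src2 \<A> \<beta>) = tgt \<A> (src2 \<A> \<alpha>)" "src \<A> (src2 \<A> \<gamma>) = tgt \<A> (src2 \<A> \<beta>)"
  shows "\<gamma> \<star> \<beta> \<star> \<alpha> = \<gamma> \<star> (\<beta> \<star> \<alpha>)"
  using hcomp2_assoc[of "src2 \<A> \<alpha>" "src \<A> (src2 \<A> \<alpha>)" "tgt \<A> (src2 \<A> \<alpha>)" \<alpha> "tgt2 \<A> \<alpha>"
      "src2 \<A> \<beta>" "tgt \<A> (src2 \<A> \<beta>)" \<beta> "tgt2 \<A> \<beta>"
      "src2 \<A> \<gamma>" "tgt \<A> (src2 \<A> \<gamma>)" \<gamma> "tgt2 \<A> \<gamma>"] assms
  by (auto simp: arrow1_def arrow2_def)

lemma one2_comp1 [simp]: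
  assumes "f \<in> Ar \<A>" "g \<in> Ar \<A>" "src \<A> g = tgt \<A> f"
  shows "one2 \<A> g \<star> one2 \<A> f = one2 \<A> (g \<cdot> f)"
  using hcomp2_one2[of f "src \<A> f" "tgt \<A> f" g "tgt \<A> g"] assms by (auto simp: arrow1_def)

text \<open>Nesting \<open>\<star>\<close> to the right separates two identity 2-cells at the left end of a composite;
  this rule merges them again, so that whiskering on the left is always by a single 1-cell.\<close>

lemma one2_comp1_hcomp2 [simp]:
  assumes "f \<in> Ar \<A>" "g \<in> Ar \<A>" "\<alpha> \<in> Tw \<A>" "src \<A> g = tgt \<A> f" "src \<A> f = tgt \<A> (src2 \<A> \<alpha>)"
  shows "one2 \<A> g \<star> (one2 \<A> f \<star> \<alpha>) = one2 \<A> (g \<cdot> f) \<star> \<alpha>"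
  using assms hcomp2_assoc'[of \<alpha> "one2 \<A> f" "one2 \<A> g"] by (simp del: hcomp2_assoc')

lemma interchange2':
  assumes "\<alpha> \<in> Tw \<A>" "\<alpha>' \<in> Tw \<A>" "\<beta> \<in> Tw \<A>" "\<beta>' \<in> Tw \<A>"
    "src2 \<A> \<alpha>' = tgt2 \<A> \<alpha>" "src2 \<A> \<beta>' = tgt2 \<A> \<beta>" "src \<A> (src2 \<A> \<beta>) = tgt \<A> (src2 \<A> \<alpha>)"
  shows "(\<beta>' \<circ>\<^sub>2 \<beta>) \<star> (\<alpha>' \<circ>\<^sub>2 \<alpha>) = (\<beta>' \<star> \<alpha>') \<circ>\<^sub>2 (\<beta> \<star> \<alpha>)"
  using interchange2[of "src2 \<A> \<alpha>" "src \<A> (src2 \<A> \<alpha>)" "tgt \<A> (src2 \<A> \<alpha>)" \<alpha> "tgt2 \<A> \<alpha>" \<alpha>' "tgt2 \<A> \<alpha>'"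
      "src2 \<A> \<beta>" "tgt \<A> (src2 \<A> \<beta>)" \<beta> "tgt2 \<A> \<beta>" \<beta>' "tgt2 \<A> \<beta>'"] assms
  by (auto simp: arrow1_def arrow2_def)

lemma whisker_comp2 [simp]:
  assumes "\<alpha> \<in> Tw \<A>" "\<beta> \<in> Tw \<A>" "f \<in> Ar \<A>" "src2 \<A> \<beta> = tgt2 \<A> \<alpha>"
  shows "src \<A> f = tgt \<A> (src2 \<A> \<alpha>) \<Longrightarrow> one2 \<A> f \<star> (\<beta> \<circ>\<^sub>2 \<alpha>) = (one2 \<A> f \<star> \<beta>) \<circ>\<^sub>2 (one2 \<A> f \<star> \<alpha>)"
    "tgt \<A> f = src \<A> (src2 \<A> \<alpha>) \<Longrightarrow> (\<beta> \<circ>\<^sub>2 \<alpha>) \<star> one2 \<A> f = (\<beta> \<star> one2 \<A> f) \<circ>\<^sub>2 (\<alpha> \<star> one2 \<A> f)"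
  using interchange2'[of \<alpha> \<beta> "one2 \<A> f" "one2 \<A> f"] interchange2'[of "one2 \<A> f" "one2 \<A> f" \<alpha> \<beta>]
    assms by simp_all

text \<open>Interchange with identities: whether \<open>\<alpha>\<close> or \<open>\<beta>\<close> is applied first does not matter, because
  either order gives \<open>\<beta> \<star> \<alpha>\<close>.\<close>

lemma hcomp2_as_whiskers:
  assumes "\<alpha> \<in> Tw \<A>" "\<beta> \<in> Tw \<A>" "src2 \<A> \<beta> = g" "src2 \<A> \<alpha> = f" "tgt2 \<A> \<beta> = g'" "tgt2 \<A> \<alpha> = f'"
    "src \<A> g = tgt \<A> f"
  shows "(\<beta> \<star> one2 \<A> f') \<circ>\<^sub>2 (one2 \<A> g \<star> \<alpha>) = \<beta> \<star> \<alpha>"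
    and "(one2 \<A> g' \<star> \<alpha>) \<circ>\<^sub>2 (\<beta> \<star> one2 \<A> f) = \<beta> \<star> \<alpha>"
  using assms interchange2'[of \<alpha> "one2 \<A> f'" "one2 \<A> g" \<beta>]
    interchange2'[of "one2 \<A> f" \<alpha> \<beta> "one2 \<A> g'"]
  by auto

text \<open>Both sides without \<open>\<zeta>\<close> are \<open>\<beta> \<star> \<alpha>\<close> by the preceding lemma. The factor \<open>\<zeta>\<close> is carried along
  because two neighbouring factors inside a right-nested composite do not form a subterm of it.\<close>

lemma whisker_exchange:
  assumes "\<alpha> \<in> Tw \<A>" "\<beta> \<in> Tw \<A>" "\<zeta> \<in> Tw \<A>" "src2 \<A> \<beta> = g" "src2 \<A> \<alpha> = f" "tgt2 \<A> \<beta> = g'"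
    "tgt2 \<A> \<alpha> = f'" "src \<A> g = tgt \<A> f" "tgt2 \<A> \<zeta> = g \<cdot> f"
  shows "(one2 \<A> g' \<star> \<alpha>) \<circ>\<^sub>2 ((\<beta> \<star> one2 \<A> f) \<circ>\<^sub>2 \<zeta>) = (\<beta> \<star> one2 \<A> f') \<circ>\<^sub>2 ((one2 \<A> g \<star> \<alpha>) \<circ>\<^sub>2 \<zeta>)"
proof -
  have "(one2 \<A> g' \<star> \<alpha>) \<circ>\<^sub>2 (\<beta> \<star> one2 \<A> f) \<circ>\<^sub>2 \<zeta> = (\<beta> \<star> one2 \<A> f') \<circ>\<^sub>2 (one2 \<A> g \<star> \<alpha>) \<circ>\<^sub>2 \<zeta>"
    using assms hcomp2_as_whiskers[of \<alpha> \<beta> g f g' f'] by simp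
  then show ?thesis
    using assms two_cell_boundary[of \<alpha>] two_cell_boundary[of \<beta>] by simp
qed

section \<open>The double category of coquintets\<close>

lemma arrow_coQ [simp]:
  "harrow (coQ \<A>) f a b \<longleftrightarrow> arrow1 \<A> f a b" "varrow (coQ \<A>) f a b \<longleftrightarrow> arrow1 \<A> f a b"
  by (simp_all add: harrow_def varrow_def arrow1_def coQ_def)

lemma cell_coQ_iff:
  "cell (coQ \<A>) \<alpha> f v w g \<longleftrightarrow>
    (\<exists>x a b c d. \<alpha> = Coquintet f v w g x \<and> x \<in> Tw \<A> \<and>
      f \<in> Ar \<A> \<and> src \<A> f = a \<and> tgt \<A> f = b \<and> v \<in> Ar \<A> \<and> src \<A> v = a \<and> tgt \<A> v = c \<and>
      w \<in> Ar \<A> \<and> src \<A> w = b \<and> tgt \<A> w = d \<and> g \<in> Ar \<A> \<and> src \<A> g = c \<and> tgt \<A> g = d \<and>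
      src2 \<A> x = g \<cdot> v \<and> tgt2 \<A> x = w \<cdot> f)"
  by (cases \<alpha>) (auto simp: cell_def coQ_def coquintets_def arrow1_def arrow2_def)

lemma coQ_ops [simp]:
  "Obj (coQ \<A>) = Ob \<A>" "Hor (coQ \<A>) = Ar \<A>" "Ver (coQ \<A>) = Ar \<A>"
  "hsrc (coQ \<A>) = src \<A>" "htgt (coQ \<A>) = tgt \<A>" "vsrc (coQ \<A>) = src \<A>" "vtgt (coQ \<A>) = tgt \<A>"
  "hone (coQ \<A>) = one \<A>" "hcomp (coQ \<A>) = comp1 \<A>" "vid (coQ \<A>) = one \<A>" "vcomp (coQ \<A>) = comp1 \<A>"
  "hone_cell (coQ \<A>) v = glob \<A> (one2 \<A> v)"
  "vid_cell (coQ \<A>) f = Coquintet f (one \<A> (src \<A> f)) (one \<A> (tgt \<A> f)) f (one2 \<A> f)"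
  "asc (coQ \<A>) x w v = glob \<A> (one2 \<A> (x \<cdot> w \<cdot> v))"
  "asc' (coQ \<A>) x w v = glob \<A> (one2 \<A> (x \<cdot> w \<cdot> v))"
  "lun (coQ \<A>) v = glob \<A> (one2 \<A> v)" "lun' (coQ \<A>) v = glob \<A> (one2 \<A> v)"
  "run (coQ \<A>) v = glob \<A> (one2 \<A> v)" "run' (coQ \<A>) v = glob \<A> (one2 \<A> v)"
  "cmp (coQ \<A>) f = f"
  "cpsi (coQ \<A>) f = Coquintet (one \<A> (src \<A> f)) (one \<A> (src \<A> f)) f f (one2 \<A> f)"
  "cchi (coQ \<A>) f = Coquintet f f (one \<A> (tgt \<A> f)) (one \<A> (tgt \<A> f)) (one2 \<A> f)"
  by (simp_all add: coQ_def)

lemma pasting_coQ [simp]: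
  "Coquintet f' w' x g' \<beta> \<odot>\<^sub>h\<^bsub>coQ \<A>\<^esub> Coquintet f v w g \<alpha> =
     Coquintet (f' \<cdot> f) v x (g' \<cdot> g) ((\<beta> \<star> one2 \<A> f) \<circ>\<^sub>2 (one2 \<A> g' \<star> \<alpha>))"
  "Coquintet f' w' x g' \<beta> \<odot>\<^sub>v\<^bsub>coQ \<A>\<^esub> Coquintet f v w g \<alpha> =
     Coquintet f (w' \<cdot> v) (x \<cdot> w) g' ((one2 \<A> x \<star> \<alpha>) \<circ>\<^sub>2 (\<beta> \<star> one2 \<A> v))"
  by (simp_all add: coQ_def)

lemma glob_one2:
  "f \<in> Ar \<A> \<Longrightarrow> glob \<A> (one2 \<A> f) = Coquintet (one \<A> (src \<A> f)) f f (one \<A> (tgt \<A> f)) (one2 \<A> f)"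
  by (simp add: glob_def)

lemma globular_glob:
  assumes "arrow2 \<A> \<alpha> f g"
  shows "globular (coQ \<A>) (glob \<A> \<alpha>) f g"
  using assms two_cell_boundary[of \<alpha>]
  by (auto simp: globular_def cell_coQ_iff glob_def arrow2_def)

lemma globularE:
  assumes "globular (coQ \<A>) \<phi> f g"
  obtains \<theta> where "\<phi> = glob \<A> \<theta>" "arrow2 \<A> \<theta> f g"
  using assms by (fastforce simp: globular_def cell_coQ_iff glob_def arrow2_def)

text \<open>With identity 1-cells as top and bottom, the whiskerings in a horizontal pasting disappear,
  and the vertical pasting is one of the two whiskered forms of \<open>\<beta> \<star> \<alpha>\<close>.\<close>

lemma pasting_glob [simp]:
  assumes "\<alpha> \<in> Tw \<A>" "\<beta> \<in> Tw \<A>"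
  shows "src2 \<A> \<beta> = tgt2 \<A> \<alpha> \<Longrightarrow> glob \<A> \<beta> \<odot>\<^sub>h\<^bsub>coQ \<A>\<^esub> glob \<A> \<alpha> = glob \<A> (\<beta> \<circ>\<^sub>2 \<alpha>)"
    "src \<A> (src2 \<A> \<beta>) = tgt \<A> (src2 \<A> \<alpha>) \<Longrightarrow>
      glob \<A> \<beta> \<odot>\<^sub>v\<^bsub>coQ \<A>\<^esub> glob \<A> \<alpha> = glob \<A> (\<beta> \<star> \<alpha>)"
  using assms hcomp2_as_whiskers(2)[of \<alpha> \<beta>] by (simp_all add: glob_def)

lemma glob_eq_iff [simp]: "glob \<A> \<alpha> = glob \<A> \<beta> \<longleftrightarrow> \<alpha> = \<beta>"
  by (auto simp: glob_def)

text \<open>Expanded, each side applies \<open>\<gamma>\<close> first and \<open>\<beta>\<close> last. Between them stand \<open>\<alpha>\<close> and \<open>\<delta>\<close>, which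
  meet only at a corner of the square of cells and occur in opposite orders on the two sides.\<close>

lemma interchange_coQ:
  assumes "cell (coQ \<A>) \<alpha> f v w g" "cell (coQ \<A>) \<beta> f' w x g'"
    "cell (coQ \<A>) \<gamma> g v' w' h" "cell (coQ \<A>) \<delta> g' w' x' h'"
  shows "(\<delta> \<odot>\<^sub>h\<^bsub>coQ \<A>\<^esub> \<gamma>) \<odot>\<^sub>v\<^bsub>coQ \<A>\<^esub> (\<beta> \<odot>\<^sub>h\<^bsub>coQ \<A>\<^esub> \<alpha>) =
    (\<delta> \<odot>\<^sub>v\<^bsub>coQ \<A>\<^esub> \<beta>) \<odot>\<^sub>h\<^bsub>coQ \<A>\<^esub> (\<gamma> \<odot>\<^sub>v\<^bsub>coQ \<A>\<^esub> \<alpha>)"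
proof -
  obtain a b c d where "\<alpha> = Coquintet f v w g a" "\<beta> = Coquintet f' w x g' b"
      "\<gamma> = Coquintet g v' w' h c" "\<delta> = Coquintet g' w' x' h' d"
    using assms by (auto simp: cell_coQ_iff)
  with assms show ?thesis
    \<comment> \<open>\<open>\<alpha>\<close> has boundary \<open>g v \<rightarrow> w f\<close> and \<open>\<delta>\<close> has boundary \<open>h' w' \<rightarrow> x' g'\<close>; the cell that
      precedes both is the whiskered \<open>\<gamma>\<close>.\<close>
    using whisker_exchange[of a d "one2 \<A> h' \<star> (c \<star> one2 \<A> v)" "h' \<cdot> w'" "g \<cdot> v" "x' \<cdot> g'" "w \<cdot> f"]
    by (auto simp: cell_coQ_iff)
qed

theorem double_category_coQ: "double_category (coQ \<A>)"
  by (unfold_locales;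
      (rule interchange_coQ; assumption |
       auto simp: cell_coQ_iff glob_one2 globular_def arrow1_def))

text \<open>Both binding cells of the companion \<open>f\<close> of \<open>f\<close> carry the 2-cell \<open>1\<^sub>f\<close>, so each binding equation
  compares identities.\<close>

theorem companions_coQ: "double_category_with_companions (coQ \<A>)"
proof -
  interpret double_category "coQ \<A>" by (rule double_category_coQ)
  show ?thesis
    by unfold_locales
      (auto simp: is_companion_def cell_coQ_iff glob_one2 arrow1_def)
qed

section \<open>Monads and their algebras\<close>

lemma monad_2cat_typing:
  assumes "monad_2cat \<A> (A, t, \<eta>, \<mu>)"
  shows "A \<in> Ob \<A>" "t \<in> Ar \<A>" "src \<A> t = A" "tgt \<A> t = A" "\<eta> \<in> Tw \<A>" "src2 \<A> \<eta> = one \<A> A"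
    "tgt2 \<A> \<eta> = t" "\<mu> \<in> Tw \<A>" "src2 \<A> \<mu> = t \<cdot> t" "tgt2 \<A> \<mu> = t"
  using assms by (auto simp: monad_2cat_def arrow1_def arrow2_def)

lemma vertical_monad_coQ:
  assumes "monad_2cat \<A> (A, t, \<eta>, \<mu>)"
  shows "vertical_monad (coQ \<A>) (A, t, glob \<A> \<eta>, glob \<A> \<mu>)"
proof -
  note T = assms[unfolded monad_2cat_def prod.case]
  show ?thesis
    unfolding vertical_monad_def prod.case
    using T globular_glob by (simp add: monad_2cat_typing[OF assms])
qed

text \<open>Since the unit and the multiplication of the identity monad and all constraints are identities,
  the two retromorphism laws shrink to \<open>\<theta> \<circ> (\<eta> \<star> 1\<^sub>u) = 1\<^sub>u\<close> and
  \<open>\<theta> \<circ> (\<mu> \<star> 1\<^sub>u) = \<theta> \<circ> (1\<^sub>t \<star> \<theta>)\<close>.\<close>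

lemma retromorphism_glob_iff:
  assumes "monad_2cat \<A> (A, t, \<eta>, \<mu>)" "X \<in> Ob \<A>"
  shows "retromorphism (coQ \<A>) (id_monad (coQ \<A>) X) (A, t, glob \<A> \<eta>, glob \<A> \<mu>) (u, glob \<A> \<theta>) \<longleftrightarrow>
    monad_algebra \<A> (A, t, \<eta>, \<mu>) X (u, \<theta>)"
proof (cases "arrow1 \<A> u X A \<and> arrow2 \<A> \<theta> (t \<cdot> u) u")
  case True
  note t = monad_2cat_typing[OF assms(1)]
  have u: "u \<in> Ar \<A>" "src \<A> u = X" "tgt \<A> u = A" "\<theta> \<in> Tw \<A>" "src2 \<A> \<theta> = t \<cdot> u" "tgt2 \<A> \<theta> = u"
    using True by (auto simp: arrow1_def arrow2_def)
  have "retrocell (coQ \<A>) (glob \<A> \<theta>) u (one \<A> X) t u"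
    using True globular_glob[of \<theta> "t \<cdot> u" u] assms(2) by (simp add: retrocell_def t u)
  then show ?thesis
    unfolding retromorphism_def id_monad_def monad_algebra_def prod.case
    using True assms(2) by (simp add: t u)
next
  case False
  \<comment> \<open>The boundary of \<open>glob \<theta>\<close> determines that of \<open>\<theta>\<close>, so neither side can hold.\<close>
  have "\<theta> \<in> Tw \<A> \<and> src2 \<A> \<theta> = v \<and> tgt2 \<A> \<theta> = w" if "globular (coQ \<A>) (glob \<A> \<theta>) v w" for v w
    using that by (auto elim!: globularE simp: arrow2_def)
  with False show ?thesis
    using assms(2)
    by (auto simp: retromorphism_def id_monad_def retrocell_def monad_algebra_def arrow1_def arrow2_def)
qed

lemma retromorphism_coQ_iff:
  assumes "monad_2cat \<A> (A, t, \<eta>, \<mu>)" "X \<in> Ob \<A>"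
  shows "retromorphism (coQ \<A>) (id_monad (coQ \<A>) X) (A, t, glob \<A> \<eta>, glob \<A> \<mu>) (u, \<phi>) \<longleftrightarrow>
    (\<exists>\<theta>. \<phi> = glob \<A> \<theta> \<and> monad_algebra \<A> (A, t, \<eta>, \<mu>) X (u, \<theta>))" (is "?L \<longleftrightarrow> ?R")
proof
  assume L: ?L
  then have "globular (coQ \<A>) \<phi> (t \<cdot> u) (u \<cdot> one \<A> X)"
    by (simp add: retromorphism_def id_monad_def retrocell_def)
  then obtain \<theta> where "\<phi> = glob \<A> \<theta>"
    by (rule globularE)
  with L show ?R
    using retromorphism_glob_iff[OF assms] by blast
next
  assume ?R
  then show ?L
    using retromorphism_glob_iff[OF assms] by blast
qed

lemma bij_betw_algebras_retromorphisms:
  assumes "monad_2cat \<A> (A, t, \<eta>, \<mu>)" "X \<in> Ob \<A>"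
  shows "bij_betw (\<lambda>(u, \<theta>). (u, glob \<A> \<theta>))
        {(u, \<theta>). monad_algebra \<A> (A, t, \<eta>, \<mu>) X (u, \<theta>)}
        {(u, \<phi>). retromorphism (coQ \<A>) (id_monad (coQ \<A>) X)
                   (A, t, glob \<A> \<eta>, glob \<A> \<mu>) (u, \<phi>)}"
  unfolding retromorphism_coQ_iff[OF assms] by (auto simp: bij_betw_def inj_on_def)

section \<open>Eilenberg--Moore objects\<close>

text \<open>Vertical composition being strict, the companion of \<open>g f\<close> is equal to the composite of the
  companions, and the comparison is an identity.\<close>

lemma cmp_coQ [simp]:
  assumes "f \<in> Ar \<A>" "g \<in> Ar \<A>" "src \<A> g = tgt \<A> f"
  shows "cmp_split (coQ \<A>) g f = glob \<A> (one2 \<A> (g \<cdot> f))"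
    "cmp_merge (coQ \<A>) g f = glob \<A> (one2 \<A> (g \<cdot> f))"
  using assms
  by (simp_all add: cmp_split_def cmp_merge_def comp_psi_def comp_chi_def glob_one2)

lemma id_retrocell_coQ:
  "f \<in> Ar \<A> \<Longrightarrow> id_retrocell (coQ \<A>) f = glob \<A> (one2 \<A> f)"
  by (simp add: id_retrocell_def glob_one2)

text \<open>The only factor of the composite retrocell that is not an identity is
  \<open>\<theta> \<bullet> h\<^sub>* : t \<bullet> u\<^sub>* \<bullet> h\<^sub>* \<Rightarrow> u\<^sub>* \<bullet> h\<^sub>*\<close>.\<close>

lemma retromorphism_comp_coQ:
  assumes "arrow1 \<A> h y x" "arrow1 \<A> u x a" "arrow1 \<A> t a a" "arrow2 \<A> \<theta> (t \<cdot> u) u"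
  shows "retromorphism_comp (coQ \<A>) (id_monad (coQ \<A>) y) (id_monad (coQ \<A>) x) (a, t, \<eta>, \<mu>)
      (u, glob \<A> \<theta>) (h, id_retrocell (coQ \<A>) h) = (u \<cdot> h, glob \<A> (\<theta> \<star> one2 \<A> h))"
proof -
  have typing: "h \<in> Ar \<A>" "src \<A> h = y" "tgt \<A> h = x" "u \<in> Ar \<A>" "src \<A> u = x" "tgt \<A> u = a"
      "t \<in> Ar \<A>" "src \<A> t = a" "tgt \<A> t = a" "\<theta> \<in> Tw \<A>" "src2 \<A> \<theta> = t \<cdot> u" "tgt2 \<A> \<theta> = u"
      "x \<in> Ob \<A>" "y \<in> Ob \<A>"
    using assms src_tgt_ob[of h] by (auto simp: arrow1_def arrow2_def)
  show ?thesis
    by (simp add: typing retromorphism_comp_def id_monad_def retrocell_comp_def id_retrocell_coQ)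
qed

text \<open>
  A competitor \<open>V\<close> in the double category is the same thing as an algebra \<open>(v, \<xi>)\<close>, and under this
  correspondence the factorization of \<open>V\<close> through \<open>h\<close> becomes \<open>v = u h\<close> and \<open>\<xi> = \<theta> \<star> 1\<^sub>h\<close>. The
  ranges of the test object agree as well: on the side of algebras it is not confined to \<open>Ob \<A>\<close>,
  but a test object with an algebra on it is the source of a 1-cell and so belongs to \<open>Ob \<A>\<close>.
\<close>

lemma EM_object_coQ_iff:
  assumes T: "monad_2cat \<A> (A, t, \<eta>, \<mu>)"
  shows "EM_object (coQ \<A>) (A, t, glob \<A> \<eta>, glob \<A> \<mu>) X (u, \<phi>) \<longleftrightarrow>
    (\<exists>\<theta>. \<phi> = glob \<A> \<theta> \<and> EM_object_2cat \<A> (A, t, \<eta>, \<mu>) X (u, \<theta>))"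
proof -
  let ?T = "(A, t, glob \<A> \<eta>, glob \<A> \<mu>)"
  let ?alg = "monad_algebra \<A> (A, t, \<eta>, \<mu>)"
  let ?retro = "\<lambda>y. retromorphism (coQ \<A>) (id_monad (coQ \<A>) y) ?T"
  let ?precomp = "\<lambda>y \<phi> h. retromorphism_comp (coQ \<A>) (id_monad (coQ \<A>) y) (id_monad (coQ \<A>) X) ?T
    (u, \<phi>) (h, id_retrocell (coQ \<A>) h)"
  have alg_ob: "y \<in> Ob \<A>" if "?alg y (v, \<xi>)" for y v \<xi>
    using that src_tgt_ob[of v] by (auto simp: monad_algebra_def arrow1_def)
  have universal_iff: "(\<forall>y \<in> Ob \<A>. \<forall>V. ?retro y V \<longrightarrow>
        (\<exists>!h. arrow1 \<A> h y X \<and> V = ?precomp y (glob \<A> \<theta>) h)) \<longleftrightarrow>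
      (\<forall>y v \<xi>. ?alg y (v, \<xi>) \<longrightarrow>
        (\<exists>!h. arrow1 \<A> h y X \<and> v = u \<cdot> h \<and> \<xi> = \<theta> \<star> one2 \<A> h))" (is "?L \<longleftrightarrow> ?R")
    if \<theta>: "?alg X (u, \<theta>)" for \<theta>
  proof -
    have factor_iff: "arrow1 \<A> h y X \<and> (v, glob \<A> \<xi>) = ?precomp y (glob \<A> \<theta>) h \<longleftrightarrow>
        arrow1 \<A> h y X \<and> v = u \<cdot> h \<and> \<xi> = \<theta> \<star> one2 \<A> h" for h y v \<xi>
      using T \<theta> retromorphism_comp_coQ[of h y X u A t \<theta>]
      by (auto simp: monad_algebra_def monad_2cat_def)
    have "?L \<longleftrightarrow> (\<forall>y \<in> Ob \<A>. \<forall>v \<xi>. ?alg y (v, \<xi>) \<longrightarrow>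
        (\<exists>!h. arrow1 \<A> h y X \<and> (v, glob \<A> \<xi>) = ?precomp y (glob \<A> \<theta>) h))"
      unfolding split_paired_All
      by (intro ball_cong refl) (simp only: retromorphism_coQ_iff[OF T], blast)
    also have "\<dots> \<longleftrightarrow> ?R"
      unfolding factor_iff using alg_ob by blast
    finally show ?thesis .
  qed
  have "EM_object (coQ \<A>) ?T X (u, \<phi>) \<longleftrightarrow> X \<in> Ob \<A> \<and> ?retro X (u, \<phi>) \<and>
      (\<forall>y \<in> Ob \<A>. \<forall>V. ?retro y V \<longrightarrow> (\<exists>!h. arrow1 \<A> h y X \<and> V = ?precomp y \<phi> h))"
    unfolding EM_object_def by simp
  also have "\<dots> \<longleftrightarrow> (\<exists>\<theta>. \<phi> = glob \<A> \<theta> \<and> ?alg X (u, \<theta>) \<and>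
      (\<forall>y \<in> Ob \<A>. \<forall>V. ?retro y V \<longrightarrow> (\<exists>!h. arrow1 \<A> h y X \<and> V = ?precomp y (glob \<A> \<theta>) h)))"
    using retromorphism_coQ_iff[OF T, of X u \<phi>] alg_ob by blast
  also have "\<dots> \<longleftrightarrow> (\<exists>\<theta>. \<phi> = glob \<A> \<theta> \<and> EM_object_2cat \<A> (A, t, \<eta>, \<mu>) X (u, \<theta>))"
    unfolding EM_object_2cat_def prod.case by (simp only: universal_iff cong: conj_cong)
  finally show ?thesis .
qed

end

theorem proposition5:
  fixes \<A> :: "('o, 'a, 'c) two_cat" and A :: 'o and t :: 'a and \<eta> \<mu> :: 'c
  assumes "two_category \<A>" and "monad_2cat \<A> (A, t, \<eta>, \<mu>)"
  shows "double_category_with_companions (coQ \<A>) \<and>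
    vertical_monad (coQ \<A>) (A, t, glob \<A> \<eta>, glob \<A> \<mu>) \<and>
    (\<forall>X \<in> Ob \<A>.
      bij_betw (\<lambda>(u, \<theta>). (u, glob \<A> \<theta>))
        {(u, \<theta>). monad_algebra \<A> (A, t, \<eta>, \<mu>) X (u, \<theta>)}
        {(u, \<phi>). retromorphism (coQ \<A>) (id_monad (coQ \<A>) X)
                   (A, t, glob \<A> \<eta>, glob \<A> \<mu>) (u, \<phi>)}) \<and>
    (\<forall>X u \<phi>.
      EM_object (coQ \<A>) (A, t, glob \<A> \<eta>, glob \<A> \<mu>) X (u, \<phi>) \<longleftrightarrow>
      (\<exists>\<theta>. \<phi> = glob \<A> \<theta> \<and> EM_object_2cat \<A> (A, t, \<eta>, \<mu>) X (u, \<theta>)))"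
proof -
  interpret two_category \<A>
    by (rule assms(1))
  show ?thesis
    using assms(2) by (intro conjI ballI allI companions_coQ vertical_monad_coQ
        bij_betw_algebras_retromorphisms EM_object_coQ_iff)
qed

end
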